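(* For all natural numbers $k$ and $d$, there exists a graph $G(k,d)$ of minimum degree at least $d$ such that every spanning tree of $G(k,d)$ contains, for every $i\in\{1,\ldots,k\}$, a vertex of degree $i$ (degree taken in the spanning tree).
   Context: All graphs are simple and finite. *)

theory Defs
  imports "Graph_Theory.Graph_Theory"
begin

text \<open>
  A finite simple graph is represented by the locale \<open>pair_graph\<close>: a finite, symmetric,
  loop-free digraph whose arcs are pairs of vertices. An edge \<open>uv\<close> is thus the pair of arcs
  \<open>(u, v)\<close> and \<open>(v, u)\<close>, so the degree of a vertex is its out-degree, which counts each
  incident edge exactly once.
\<close>

definition vertex_degree :: "'a pair_pre_digraph \<Rightarrow> 'a \<Rightarrow> nat" where
  "vertex_degree G v = out_degree (with_proj G) v"

text \<open>Only meaningful if the vertex set is finite and nonempty.\<close>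

definition min_degree :: "'a pair_pre_digraph \<Rightarrow> nat" where
  "min_degree G = Min (vertex_degree G ` pverts G)"

text \<open>
  The predicates \<open>forest\<close> and \<open>tree\<close> of the library forbid directed cycles, including the
  closed walk \<open>u, v, u\<close> along the two arcs of a single edge, so no symmetric digraph with an
  edge satisfies them. The cycles of a simple graph are the directed cycles of length
  at least 3 of its symmetric digraph.
\<close>

definition acyclic_graph :: "'a pair_pre_digraph \<Rightarrow> bool" where
  "acyclic_graph G \<longleftrightarrow> \<not> (\<exists>p. pre_digraph.cycle (with_proj G) p \<and> 3 \<le> length p)"

definition tree_graph :: "'a pair_pre_digraph \<Rightarrow> bool" where
  "tree_graph T \<longleftrightarrow>
    pair_graph T \<and> Digraph_Component.connected (with_proj T) \<and> acyclic_graph T"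

definition spanning_tree_graph :: "'a pair_pre_digraph \<Rightarrow> 'a pair_pre_digraph \<Rightarrow> bool" where
  "spanning_tree_graph T G \<longleftrightarrow> tree_graph T \<and> spanning (with_proj T) (with_proj G)"

end

theory Submission
  imports Defs "HOL-Library.Countable"
begin

text \<open>
  Join many vertices \<open>u\<close>, the stems, to all of \<open>d + 1\<close> hubs, and attach to each stem
  \<open>i\<close> copies of a complete graph on \<open>d + 1\<close> vertices by bridges. A spanning tree \<open>T\<close> contains all
  the bridges and at least one edge from each stem to a hub, so a stem has degree \<open>i + 1\<close> in \<open>T\<close>
  unless it is adjacent in \<open>T\<close> to two hubs. With more stems than pairs of hubs, two stems
  of the latter kind would share a pair of hubs and thus lie on a 4-cycle of \<open>T\<close>.
\<close>

section \<open>Degrees, cuts and 4-cycles\<close>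

lemma vertex_degree_eq_card: "vertex_degree G v = card {w. (v, w) \<in> parcs G}"
proof -
  have "out_arcs (with_proj G) v = Pair v ` {w. (v, w) \<in> parcs G}"
    by (auto simp: out_arcs_def)
  then show ?thesis
    by (simp add: vertex_degree_def out_degree_def card_image inj_on_def)
qed

text \<open>A walk from \<open>x\<close> to \<open>y\<close> has to leave \<open>S\<close>
  somewhere. Applied to a spanning tree, this forces edges across chosen cuts.\<close>

lemma connected_crossing_arc:
  assumes "pair_graph G" "Digraph_Component.connected (with_proj G)"
    and "x \<in> pverts G" "y \<in> pverts G" "x \<in> S" "y \<notin> S"
  obtains u v where "u \<in> S" "v \<notin> S" "(u, v) \<in> parcs G"
proof -
  interpret pair_graph G by fact
  have "strongly_connected (with_proj G)"
    using assms(2) sym_arcs by (intro symmetric_connected_imp_strongly_connected)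
  then have "x \<rightarrow>\<^sup>*\<^bsub>with_proj G\<^esub> y"
    using assms(3,4) by (auto elim: strongly_connectedE)
  then have "(x, y) \<in> (parcs G)\<^sup>*"
    by (auto dest: reachable_rtranclI)
  then have "\<exists>u v. u \<in> S \<and> v \<notin> S \<and> (u, v) \<in> parcs G"
    using assms(5,6) by (induction rule: rtrancl_induct) auto
  then show thesis
    using that by blast
qed

lemma acyclic_graph_no_4_cycle:
  assumes "pair_graph G" "acyclic_graph G" "distinct [a, b, c, d]"
    and "(a, b) \<in> parcs G" "(b, c) \<in> parcs G" "(c, d) \<in> parcs G" "(d, a) \<in> parcs G"
  shows False
proof -
  interpret pair_graph G by fact
  have "cycle [(a, b), (b, c), (c, d), (d, a)]"
    unfolding cycle_def awalk_def using assms(3-) in_arcsD1[OF assms(4)]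
    by (intro exI[of _ a]) auto
  then show False
    using assms(2) by (auto simp: acyclic_graph_def)
qed

section \<open>The graph\<close>

datatype vertex = Hub nat | Stem nat nat | Clique nat nat nat nat

text \<open>Countability supplies the injection \<open>to_nat\<close>, which turns structured
  vertices into the natural numbers used as vertices of the graph.\<close>

instance vertex :: countable
  by countable_datatype

text \<open>
  \<open>Stem i j\<close> is the \<open>j\<close>-th stem with \<open>i\<close> bridges, and \<open>Clique i j t s\<close> is the \<open>s\<close>-th vertex of the
  complete graph at the end of its \<open>t\<close>-th bridge, with \<open>s = 0\<close> the endpoint of the bridge.
\<close>

fun valid :: "nat \<Rightarrow> nat \<Rightarrow> vertex \<Rightarrow> bool" where
  "valid k d (Hub x) \<longleftrightarrow> x \<le> d"
| "valid k d (Stem i j) \<longleftrightarrow> i \<le> k \<and> j \<le> (d + 1)\<^sup>2"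
| "valid k d (Clique i j t s) \<longleftrightarrow> i \<le> k \<and> j \<le> (d + 1)\<^sup>2 \<and> t < i \<and> s \<le> d"

text \<open>No two stems are adjacent, so the neighbours of a stem are the hubs and the endpoints of
  its own bridges. Stems with different numbers of bridges share the same hubs.\<close>

fun joined :: "vertex \<Rightarrow> vertex \<Rightarrow> bool" where
  "joined (Hub x) (Stem i j) \<longleftrightarrow> True"
| "joined (Stem i j) (Hub x) \<longleftrightarrow> True"
| "joined (Stem i j) (Clique i' j' t s) \<longleftrightarrow> i' = i \<and> j' = j \<and> s = 0"
| "joined (Clique i' j' t s) (Stem i j) \<longleftrightarrow> i' = i \<and> j' = j \<and> s = 0"
| "joined (Clique i j t s) (Clique i' j' t' s') \<longleftrightarrow> i' = i \<and> j' = j \<and> t' = t \<and> s' \<noteq> s"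
| "joined _ _ \<longleftrightarrow> False"

definition stem_graph :: "nat \<Rightarrow> nat \<Rightarrow> nat pair_pre_digraph" where
  "stem_graph k d = \<lparr>pverts = to_nat ` Collect (valid k d),
    parcs = {(to_nat x, to_nat y) | x y. valid k d x \<and> valid k d y \<and> joined x y}\<rparr>"

lemma joined_sym: "joined x y \<Longrightarrow> joined y x"
  by (induction x y rule: joined.induct) auto

lemma joined_irrefl: "\<not> joined x x"
  by (cases x) auto

lemma pverts_stem_graph_iff [simp]: "to_nat x \<in> pverts (stem_graph k d) \<longleftrightarrow> valid k d x"
  by (auto simp: stem_graph_def)

lemma parcs_stem_graph_iff [simp]:
  "(to_nat x, to_nat y) \<in> parcs (stem_graph k d) \<longleftrightarrow> valid k d x \<and> valid k d y \<and> joined x y"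
  by (auto simp: stem_graph_def)

lemma parcs_stem_graphE:
  assumes "(u, v) \<in> parcs (stem_graph k d)"
  obtains x y where "u = to_nat x" "v = to_nat y" "valid k d x" "valid k d y" "joined x y"
  using assms by (auto simp: stem_graph_def)

lemma finite_valid: "finite (Collect (valid k d))"
proof (rule finite_subset)
  let ?N = "{..(d + 1)\<^sup>2}"
  show "Collect (valid k d) \<subseteq> Hub ` {..d} \<union> (\<lambda>(i, j). Stem i j) ` ({..k} \<times> ?N)
    \<union> (\<lambda>(i, j, t, s). Clique i j t s) ` ({..k} \<times> ?N \<times> {..k} \<times> {..d})"
  proof
    fix x
    assume "x \<in> Collect (valid k d)"
    then show "x \<in> Hub ` {..d} \<union> (\<lambda>(i, j). Stem i j) ` ({..k} \<times> ?N)
      \<union> (\<lambda>(i, j, t, s). Clique i j t s) ` ({..k} \<times> ?N \<times> {..k} \<times> {..d})"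
      by (cases x) (auto simp: image_iff)
  qed
qed auto

lemma pair_graph_stem_graph: "pair_graph (stem_graph k d)"
proof
  show "finite (pverts (stem_graph k d))"
    using finite_valid by (simp add: stem_graph_def)
  then have "finite (pverts (stem_graph k d) \<times> pverts (stem_graph k d))"
    by simp
  then show "finite (parcs (stem_graph k d))"
    by (rule finite_subset[rotated]) (auto simp: stem_graph_def)
  show "symmetric (with_proj (stem_graph k d))"
    by (auto simp: symmetric_def sym_def stem_graph_def dest: joined_sym)
qed (auto simp: stem_graph_def joined_irrefl)

text \<open>Without connectedness there would be no spanning tree, and the claim about spanning
  trees would be vacuous. Every vertex is led to \<open>Hub 0\<close>: a clique through its bridge
  to its stem, and a stem directly.\<close>

lemma connected_stem_graph: "Digraph_Component.connected (with_proj (stem_graph k d))"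
proof -
  let ?G = "stem_graph k d"
  interpret G: pair_graph ?G
    by (rule pair_graph_stem_graph)
  have step: "to_nat x \<rightarrow>\<^sup>*\<^bsub>with_proj ?G\<^esub> to_nat (Hub 0)"
    if "to_nat y \<rightarrow>\<^sup>*\<^bsub>with_proj ?G\<^esub> to_nat (Hub 0)" "valid k d x" "valid k d y" "joined x y" for x y
    using that by (intro G.adj_reachable_trans[OF _ that(1)]) simp
  have hub: "to_nat (Hub 0) \<rightarrow>\<^sup>*\<^bsub>with_proj ?G\<^esub> to_nat (Hub 0)"
    by (intro G.reachable_refl) simp
  have stem: "to_nat (Stem i j) \<rightarrow>\<^sup>*\<^bsub>with_proj ?G\<^esub> to_nat (Hub 0)" if "valid k d (Stem i j)" for i j
    using that by (intro step[OF hub]) auto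
  have clique0: "to_nat (Clique i j t 0) \<rightarrow>\<^sup>*\<^bsub>with_proj ?G\<^esub> to_nat (Hub 0)"
    if "valid k d (Clique i j t 0)" for i j t
    using that by (intro step[OF stem[of i j]]) auto
  have reach: "to_nat x \<rightarrow>\<^sup>*\<^bsub>with_proj ?G\<^esub> to_nat (Hub 0)" if "valid k d x" for x
  proof (cases x)
    case (Hub m)
    \<comment> \<open>\<open>Stem 0 0\<close> is valid for all \<open>k\<close> and
      \<open>d\<close>.\<close>
    with that show ?thesis by (auto intro!: step[OF stem[of 0 0]])
  next
    case (Stem i j)
    with that show ?thesis by (simp add: stem)
  next
    case (Clique i j t s)
    with that show ?thesis
      by (cases "s = 0") (auto simp: clique0 intro!: step[OF clique0[of i j t]])
  qed
  have "strongly_connected (with_proj ?G)"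
  proof
    show "verts (with_proj ?G) \<noteq> {}"
      using pverts_stem_graph_iff[of "Hub 0" k d] by (auto simp del: pverts_stem_graph_iff)
    fix u v
    assume "u \<in> verts (with_proj ?G)" "v \<in> verts (with_proj ?G)"
    then obtain x y where "u = to_nat x" "v = to_nat y" "valid k d x" "valid k d y"
      by (auto simp: stem_graph_def)
    then show "u \<rightarrow>\<^sup>*\<^bsub>with_proj ?G\<^esub> v"
      using G.reachable_trans[OF reach G.symmetric_reachable'[OF reach]] by simp
  qed
  \<comment> \<open>\<open>connected\<close> refers to the symmetric closure, which has the same
    reachability because the graph is already symmetric.\<close>
  moreover have "pverts (mk_symmetric (with_proj ?G)) = pverts ?G"
    by (simp add: mk_symmetric_def)
  ultimately show ?thesis
    unfolding Digraph_Component.connected_def strongly_connected_def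
    by (simp add: G.reachable_mk_symmetric_eq[OF G.sym_arcs])
qed

lemma vertex_degree_to_nat:
  fixes x :: vertex
  assumes "parcs T \<subseteq> parcs (stem_graph k d)"
  shows "vertex_degree T (to_nat x) = card {y :: vertex. (to_nat x, to_nat y) \<in> parcs T}"
proof -
  have "{w. (to_nat x, w) \<in> parcs T} = to_nat ` {y :: vertex. (to_nat x, to_nat y) \<in> parcs T}"
    using assms by (blast elim: parcs_stem_graphE)
  then show ?thesis
    by (simp add: vertex_degree_eq_card card_image)
qed

text \<open>A hub sees all stems without bridges, a stem sees \<open>d + 1\<close> hubs, and a
  clique vertex sees the \<open>d\<close> other vertices of its clique.\<close>

lemma vertex_degree_stem_graph_ge:
  assumes "valid k d x"
  shows "d \<le> vertex_degree (stem_graph k d) (to_nat x)"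
proof -
  have "\<exists>S \<subseteq> {y. valid k d y \<and> joined x y}. card S \<ge> d"
  proof (cases x)
    case (Hub m)
    have "card (Stem 0 ` {..(d + 1)\<^sup>2}) = (d + 1)\<^sup>2 + 1"
      by (simp add: card_image inj_on_def)
    also have "\<dots> \<ge> d"
      by (simp add: power2_eq_square)
    finally show ?thesis
      using assms Hub by (intro exI[of _ "Stem 0 ` {..(d + 1)\<^sup>2}"]) auto
  next
    case (Stem i j)
    then show ?thesis
      using assms by (intro exI[of _ "Hub ` {..d}"]) (auto simp: card_image inj_on_def)
  next
    case (Clique i j t s)
    then have "card (Clique i j t ` ({..d} - {s})) = d"
      using assms by (simp add: card_image inj_on_def)
    then show ?thesis
      using assms Clique by (intro exI[of _ "Clique i j t ` ({..d} - {s})"]) auto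
  qed
  then obtain S where S: "S \<subseteq> {y. valid k d y \<and> joined x y}" "card S \<ge> d"
    by blast
  have "finite {y. valid k d y \<and> joined x y}"
    by (rule finite_subset[OF _ finite_valid]) auto
  then have "card S \<le> card {y. valid k d y \<and> joined x y}"
    using S(1) by (rule card_mono)
  then show ?thesis
    using S(2) assms by (simp add: vertex_degree_to_nat[OF subset_refl])
qed

lemma min_degree_stem_graph: "d \<le> min_degree (stem_graph k d)"
proof -
  have *: "pverts (stem_graph k d) = to_nat ` Collect (valid k d)"
    by (simp add: stem_graph_def)
  have "valid k d (Hub 0)"
    by simp
  then have "Collect (valid k d) \<noteq> {}"
    by blast
  then show ?thesis
    unfolding min_degree_def * using finite_valid vertex_degree_stem_graph_ge
    by (subst Min_ge_iff) auto
qed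

section \<open>Spanning trees\<close>

lemma spanning_tree_stem_degree:
  assumes "spanning_tree_graph T (stem_graph k d)" "i \<le> k"
  shows "\<exists>v\<in>pverts T. vertex_degree T v = i + 1"
proof (rule ccontr)
  assume no_degree: "\<not> ?thesis"
  \<comment> \<open>The edges of \<open>T\<close> are pulled back to \<open>vertex\<close>, where
    case analysis with \<open>joined\<close> applies.\<close>
  define R where "R x y \<longleftrightarrow> (to_nat x, to_nat y) \<in> parcs T" for x y :: vertex
  have T: "pair_graph T" "Digraph_Component.connected (with_proj T)" "acyclic_graph T"
    and verts: "pverts T = pverts (stem_graph k d)"
    and sub: "parcs T \<subseteq> parcs (stem_graph k d)"
    using assms(1)
    by (auto simp: spanning_tree_graph_def tree_graph_def spanning_def subgraph_def)
  interpret T: pair_graph T by fact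
  have R_sym: "R y x" if "R x y" for x y
    using that T.arcs_symmetric by (simp add: R_def)
  have R_joined: "valid k d x \<and> valid k d y \<and> joined x y" if "R x y" for x y
    using that sub parcs_stem_graph_iff unfolding R_def by blast
  have crossing: "\<exists>u v. u \<in> S \<and> v \<notin> S \<and> R u v"
    if xy: "valid k d x" "valid k d y" "x \<in> S" "y \<notin> S" for x y S
  proof -
    obtain u v where "u \<in> to_nat ` S" "v \<notin> to_nat ` S" "(u, v) \<in> parcs T"
      by (rule connected_crossing_arc[OF T(1,2), of "to_nat x" "to_nat y" "to_nat ` S"])
        (use xy in \<open>auto simp: verts\<close>)
    then show ?thesis
      using sub by (auto simp: R_def elim!: parcs_stem_graphE dest!: subsetD)
  qed
  have bridge: "R (Stem i j) (Clique i j t 0)" if "j \<le> (d + 1)\<^sup>2" "t < i" for j t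
  proof -
    \<comment> \<open>The bridge is the only edge of the graph that leaves this clique.\<close>
    have "\<exists>u v. u \<in> range (Clique i j t) \<and> v \<notin> range (Clique i j t) \<and> R u v"
      using that assms(2) by (intro crossing[of "Clique i j t 0" "Hub 0"]) auto
    then obtain u v where "u \<in> range (Clique i j t)" "v \<notin> range (Clique i j t)" "R u v"
      by blast
    moreover from this have "v = Stem i j \<and> u = Clique i j t 0"
      using R_joined[of u v] by (cases v) auto
    ultimately show ?thesis
      using R_sym by blast
  qed
  define H where "H j = {x. R (Stem i j) (Hub x)}" for j
  have H_le: "H j \<subseteq> {..d}" for j
    using R_joined by (fastforce simp: H_def)
  have H_nonempty: "H j \<noteq> {}" if "j \<le> (d + 1)\<^sup>2" for j
  proof -
    \<comment> \<open>For the stem together with all its cliques, the only edges leaving the set run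
      from the stem to hubs.\<close>
    let ?S = "insert (Stem i j) {Clique i j t s | t s. True}"
    have "\<exists>u v. u \<in> ?S \<and> v \<notin> ?S \<and> R u v"
      using that assms(2) by (intro crossing[of "Stem i j" "Hub 0"]) auto
    then obtain u v where "u \<in> ?S" "v \<notin> ?S" "R u v"
      by blast
    moreover from this have "u = Stem i j \<and> (\<exists>x. v = Hub x)"
      using R_joined[of u v] by (cases v) auto
    ultimately show ?thesis
      by (auto simp: H_def)
  qed
  have H_card: "card (H j) \<noteq> 1" if j: "j \<le> (d + 1)\<^sup>2" for j
  proof
    assume "card (H j) = 1"
    \<comment> \<open>All \<open>i\<close> bridges lie in \<open>T\<close>, so a single hub
      neighbour would give the excluded degree \<open>i + 1\<close>.\<close>
    have nbrs: "{y. R (Stem i j) y} = (\<lambda>t. Clique i j t 0) ` {..<i} \<union> Hub ` H j" (is "?L = ?C \<union> ?H")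
    proof (intro equalityI subsetI)
      fix y
      assume "y \<in> ?L"
      then show "y \<in> ?C \<union> ?H"
        using R_joined[of "Stem i j" y] by (cases y) (auto simp: H_def)
    qed (use j bridge in \<open>auto simp: H_def\<close>)
    have "card ?L = card ?C + card ?H"
      unfolding nbrs using finite_subset[OF H_le]
      by (intro card_Un_disjoint) auto
    also have "\<dots> = i + 1"
      using \<open>card (H j) = 1\<close> by (simp add: card_image inj_on_def)
    finally have "vertex_degree T (to_nat (Stem i j)) = i + 1"
      by (simp add: vertex_degree_to_nat[OF sub] R_def)
    moreover have "to_nat (Stem i j) \<in> pverts T"
      using j assms(2) by (simp add: verts)
    ultimately show False
      using no_degree by blast
  qed
  have "\<exists>p. p \<in> H j \<times> H j \<and> fst p \<noteq> snd p" if j: "j \<le> (d + 1)\<^sup>2" for j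
  proof -
    obtain x where "x \<in> H j"
      using H_nonempty[OF j] by blast
    moreover have "H j \<noteq> {x}"
      using H_card[OF j] by auto
    ultimately show ?thesis
      by auto
  qed
  then obtain f where f: "\<And>j. j \<le> (d + 1)\<^sup>2 \<Longrightarrow> f j \<in> H j \<times> H j \<and> fst (f j) \<noteq> snd (f j)"
    by metis
  have "f j \<in> {..d} \<times> {..d}" if "j \<le> (d + 1)\<^sup>2" for j
    using f[OF that] H_le[of j] by (metis Sigma_mono subsetD)
  then have "card (f ` {..(d + 1)\<^sup>2}) \<le> card ({..d} \<times> {..d})"
    by (intro card_mono image_subsetI) simp_all
  \<comment> \<open>The index \<open>j\<close> starts at 0, so there are
    \<open>(d + 1)\<^sup>2 + 1\<close> stems with \<open>i\<close> bridges, one more than the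
    ordered pairs of hubs.\<close>
  also have "\<dots> < card {..(d + 1)\<^sup>2}"
    by (simp add: power2_eq_square)
  finally have "\<not> inj_on f {..(d + 1)\<^sup>2}"
    by (rule pigeonhole)
  then obtain j j' where jj: "j \<le> (d + 1)\<^sup>2" "j' \<le> (d + 1)\<^sup>2" "j \<noteq> j'" "f j = f j'"
    by (auto simp: inj_on_def)
  obtain x x' where "f j = (x, x')"
    by fastforce
  then have "x \<noteq> x'" "R (Stem i j) (Hub x)" "R (Stem i j) (Hub x')"
    "R (Stem i j') (Hub x)" "R (Stem i j') (Hub x')"
    using f[OF jj(1)] f[OF jj(2)] jj(4) by (auto simp: H_def)
  \<comment> \<open>The stems \<open>j\<close> and \<open>j'\<close> share the two hubs
    \<open>x\<close> and \<open>x'\<close>, which closes a 4-cycle in \<open>T\<close>.\<close>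
  then show False
    using acyclic_graph_no_4_cycle[OF T(1,3), of "to_nat (Stem i j)" "to_nat (Hub x)"
        "to_nat (Stem i j')" "to_nat (Hub x')"] jj(3) R_sym
    by (auto simp: R_def)
qed

theorem theorem2p2:
  fixes k d :: nat
  shows "\<exists>G :: nat pair_pre_digraph.
    pair_graph G \<and> Digraph_Component.connected (with_proj G) \<and> min_degree G \<ge> d \<and>
    (\<forall>T. spanning_tree_graph T G \<longrightarrow>
      (\<forall>i\<in>{1..k}. \<exists>v\<in>pverts T. vertex_degree T v = i))"
proof (intro exI[of _ "stem_graph k d"] conjI allI impI ballI)
  fix T i
  assume "spanning_tree_graph T (stem_graph k d)" "i \<in> {1..k}"
  then show "\<exists>v\<in>pverts T. vertex_degree T v = i"
    \<comment> \<open>Degree \<open>i\<close> comes from the stems with \<open>i - 1\<close>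
      bridges, the remaining edge going to a hub; \<open>i \<ge> 1\<close> makes the subtraction
      exact.\<close>
    using spanning_tree_stem_degree[of T k d "i - 1"] by auto
qed (rule pair_graph_stem_graph connected_stem_graph min_degree_stem_graph)+

end
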